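(* If a cube $A\in\mathcal{C}^3_3(v,k,\lambda)$ exists, then $$\lambda v(v-1)\ge k(k-v).$$ Equality holds if and only if every row-sum of $A$ is $k/v$. In that case, $(v,k,\lambda)=(v,vk',v\lambda')$ for some non-negative integers $k',\lambda'$ such that $(v,k',\lambda')$ are admissible parameters of cubes of propriety $2$, i.e. $\lambda'(v-1)=k'(k'-1)$.
   Context: A $v\times v\times v$ array is a function on $\{1,\dots,v\}^3$. A layer is a 2-dimensional subarray obtained by fixing one of the three coordinates; a row is a 1-dimensional subarray obtained by fixing two of the three coordinates (any two), and its row-sum is the sum of its $v$ entries. Two layers are parallel if they fix the same coordinate, to different values; their scalar product is the sum over all positions of the product of corresponding entries. $\mathcal{C}^3_3(v,k,\lambda)$ is the set of $v\times v\times v$ arrays over $\{0,1\}$ such that every layer (in each of the three directions) contains exactly $k$ ones and every two parallel layers have scalar product $\lambda$. (Cubes of propriety 2 with parameters $(v,k',\lambda')$ are $v\times v\times v$ arrays all of whose layers are incidence matrices of symmetric $(v,k',\lambda')$ designs; "admissible" refers to the necessary condition $\lambda'(v-1)=k'(k'-1)$ on their parameters.) *)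

theory Defs
  imports Complex_Main "HOL-Library.FuncSet"
begin

datatype axis = Axis1 | Axis2 | Axis3

text \<open>
  Position of a three-dimensional array obtained by putting \<open>a\<close> at the coordinate given by the
  axis and the pair at the other two coordinates, in increasing order.  Letting the pair vary
  traces out a layer, letting \<open>a\<close> vary traces out a row.
\<close>
fun position :: "axis \<Rightarrow> nat \<Rightarrow> nat \<times> nat \<Rightarrow> nat \<times> nat \<times> nat" where
  "position Axis1 a (b, c) = (a, b, c)"
| "position Axis2 a (b, c) = (b, a, c)"
| "position Axis3 a (b, c) = (b, c, a)"

definition arrays01 :: "nat \<Rightarrow> (nat \<times> nat \<times> nat \<Rightarrow> nat) set" where
  "arrays01 v = ({1..v} \<times> {1..v} \<times> {1..v}) \<rightarrow>\<^sub>E {0, 1}"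

definition layer :: "(nat \<times> nat \<times> nat \<Rightarrow> nat) \<Rightarrow> axis \<Rightarrow> nat \<Rightarrow> nat \<times> nat \<Rightarrow> nat" where
  "layer A d a = (\<lambda>p. A (position d a p))"

definition row :: "(nat \<times> nat \<times> nat \<Rightarrow> nat) \<Rightarrow> axis \<Rightarrow> nat \<times> nat \<Rightarrow> nat \<Rightarrow> nat" where
  "row A d p = (\<lambda>a. A (position d a p))"

definition row_sum :: "nat \<Rightarrow> (nat \<times> nat \<times> nat \<Rightarrow> nat) \<Rightarrow> axis \<Rightarrow> nat \<times> nat \<Rightarrow> nat" where
  "row_sum v A d p = (\<Sum>a\<in>{1..v}. row A d p a)"

definition scalar_product :: "nat \<Rightarrow> (nat \<times> nat \<Rightarrow> nat) \<Rightarrow> (nat \<times> nat \<Rightarrow> nat) \<Rightarrow> nat" where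
  "scalar_product v L M = (\<Sum>p\<in>{1..v} \<times> {1..v}. L p * M p)"

text \<open>The set \<open>C\<^sup>3\<^sub>3(v, k, \<lambda>)\<close>.\<close>
definition cubes33 :: "nat \<Rightarrow> nat \<Rightarrow> nat \<Rightarrow> (nat \<times> nat \<times> nat \<Rightarrow> nat) set" where
  "cubes33 v k lam = {A \<in> arrays01 v.
     (\<forall>d. \<forall>a\<in>{1..v}. card {p \<in> {1..v} \<times> {1..v}. layer A d a p = 1} = k) \<and>
     (\<forall>d. \<forall>a\<in>{1..v}. \<forall>b\<in>{1..v}. a \<noteq> b \<longrightarrow>
        scalar_product v (layer A d a) (layer A d b) = lam)}"

text \<open>
  The necessary condition on the parameters of a cube of propriety 2, that is, of symmetric
  designs; admissibility does not assert that such a cube exists.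
\<close>
definition admissible :: "nat \<Rightarrow> nat \<Rightarrow> nat \<Rightarrow> bool" where
  "admissible v k lam \<longleftrightarrow> int lam * (int v - 1) = int k * (int k - 1)"

end

theory Submission
  imports Defs
begin

text \<open>
  Fix a direction and let \<open>r\<^sub>p\<close> be the row-sums in it. Double counting gives
  \<open>\<Sum>r\<^sub>p = vk\<close> and \<open>\<Sum>r\<^sub>p\<^sup>2 = vk + v(v - 1)\<lambda>\<close>, the second because the square of the sum of
  the \<open>v\<close> parallel layers expands into their pairwise scalar products. Hence
  \<open>\<Sum>(v r\<^sub>p - k)\<^sup>2 = v\<^sup>2(\<lambda>v(v - 1) - k(k - v))\<close>, which yields the inequality and its equality
  case. Under equality \<open>k = vk'\<close> for the constant row-sum \<open>k'\<close>, so
  \<open>\<lambda>(v - 1) = v k'(k' - 1)\<close>, and \<open>v\<close> divides \<open>\<lambda>\<close> since it is coprime to \<open>v - 1\<close>.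
\<close>

lemma layer_01:
  assumes "A \<in> arrays01 v" "a \<in> {1..v}" "p \<in> {1..v} \<times> {1..v}"
  shows "layer A d a p \<in> {0, 1}"
proof -
  have "position d a p \<in> {1..v} \<times> {1..v} \<times> {1..v}"
    using assms(2,3) by (cases d; cases p) auto
  with assms(1)[unfolded arrays01_def] show ?thesis
    unfolding layer_def by (rule PiE_mem)
qed

lemma sum_layer:
  assumes "A \<in> cubes33 v k lam" "a \<in> {1..v}"
  shows "(\<Sum>p\<in>{1..v} \<times> {1..v}. layer A d a p) = k"
proof -
  have A: "A \<in> arrays01 v" using assms(1) by (simp add: cubes33_def)
  have "(\<Sum>p\<in>{1..v} \<times> {1..v}. layer A d a p)
      = (\<Sum>p\<in>{1..v} \<times> {1..v}. if layer A d a p = 1 then 1 else 0)"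
  proof (rule sum.cong[OF refl])
    fix p assume "p \<in> {1..v} \<times> {1..v}"
    from layer_01[OF A assms(2) this, of d]
    show "layer A d a p = (if layer A d a p = 1 then 1 else 0)" by auto
  qed
  also have "\<dots> = card {p \<in> {1..v} \<times> {1..v}. layer A d a p = 1}"
    by (simp only: card_eq_sum sum.inter_filter finite_cartesian_product finite_atLeastAtMost)
  finally show ?thesis
    using assms by (simp add: cubes33_def)
qed

text \<open>Entries are 0 or 1, so squaring does not change them and a layer multiplied by itself
  yields its number of ones. With the diagonal included, this is the full Gram matrix of the
  parallel layers.\<close>

lemma scalar_product_layers:
  assumes "A \<in> cubes33 v k lam" "a \<in> {1..v}" "b \<in> {1..v}"
  shows "scalar_product v (layer A d a) (layer A d b) = (if a = b then k else lam)"
proof (cases "a = b")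
  case True
  have A: "A \<in> arrays01 v" using assms(1) by (simp add: cubes33_def)
  have "scalar_product v (layer A d a) (layer A d a) = (\<Sum>p\<in>{1..v} \<times> {1..v}. layer A d a p)"
    unfolding scalar_product_def
  proof (rule sum.cong[OF refl])
    fix p assume "p \<in> {1..v} \<times> {1..v}"
    from layer_01[OF A assms(2) this, of d]
    show "layer A d a p * layer A d a p = layer A d a p" by auto
  qed
  then show ?thesis using True sum_layer[OF assms(1,2), of d] by simp
next
  case False
  then show ?thesis using assms by (simp add: cubes33_def)
qed

lemma row_sum_eq_sum_layer: "row_sum v A d p = (\<Sum>a\<in>{1..v}. layer A d a p)"
  by (simp add: row_sum_def row_def layer_def)

lemma sum_row_sum:
  assumes "A \<in> cubes33 v k lam"
  shows "(\<Sum>p\<in>{1..v} \<times> {1..v}. row_sum v A d p) = v * k"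
proof -
  have "(\<Sum>p\<in>{1..v} \<times> {1..v}. row_sum v A d p)
      = (\<Sum>a\<in>{1..v}. \<Sum>p\<in>{1..v} \<times> {1..v}. layer A d a p)"
    unfolding row_sum_eq_sum_layer by (rule sum.swap)
  also have "\<dots> = (\<Sum>a\<in>{1..v}. k)"
    using sum_layer[OF assms] by (rule sum.cong[OF refl])
  finally show ?thesis by simp
qed

lemma sum_row_sum_square:
  assumes "A \<in> cubes33 v k lam"
  shows "(\<Sum>p\<in>{1..v} \<times> {1..v}. (row_sum v A d p)\<^sup>2) = v * (k + (v - 1) * lam)"
proof -
  have "(\<Sum>p\<in>{1..v} \<times> {1..v}. (row_sum v A d p)\<^sup>2)
      = (\<Sum>p\<in>{1..v} \<times> {1..v}. \<Sum>a\<in>{1..v}. \<Sum>b\<in>{1..v}. layer A d a p * layer A d b p)"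
    by (simp add: row_sum_eq_sum_layer power2_eq_square sum_product)
  also have "\<dots> = (\<Sum>a\<in>{1..v}. \<Sum>p\<in>{1..v} \<times> {1..v}. \<Sum>b\<in>{1..v}. layer A d a p * layer A d b p)"
    by (rule sum.swap)
  also have "\<dots> = (\<Sum>a\<in>{1..v}. \<Sum>b\<in>{1..v}. scalar_product v (layer A d a) (layer A d b))"
    unfolding scalar_product_def by (intro sum.cong refl sum.swap)
  also have "\<dots> = (\<Sum>a\<in>{1..v}. \<Sum>b\<in>{1..v}. if a = b then k else lam)"
    by (intro sum.cong refl scalar_product_layers[OF assms])
  \<comment> \<open>Each row of the Gram matrix has one diagonal entry \<open>k\<close> and
    \<open>v - 1\<close> entries \<open>lam\<close>.\<close>
  also have "\<dots> = (\<Sum>a\<in>{1..v}. k + (v - 1) * lam)"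
  proof (rule sum.cong[OF refl])
    fix a assume a: "a \<in> {1..v}"
    then have "(\<Sum>b\<in>{1..v}. if a = b then k else lam)
        = k + (\<Sum>b\<in>{1..v} - {a}. if a = b then k else lam)"
      by (simp add: sum.remove)
    also have "(\<Sum>b\<in>{1..v} - {a}. if a = b then k else lam) = (\<Sum>b\<in>{1..v} - {a}. lam)"
      by (rule sum.cong) auto
    finally show "(\<Sum>b\<in>{1..v}. if a = b then k else lam) = k + (v - 1) * lam"
      using a by simp
  qed
  finally show ?thesis by simp
qed

text \<open>The \<open>v * v\<close> rows in one direction share \<open>v * k\<close> ones, so their
  mean row-sum is k/v. The sum measures the squared deviation from this mean, scaled by
  \<open>v\<close> so that everything stays in the integers.\<close>

lemma row_sum_deviation:
  assumes "v \<ge> 1" "A \<in> cubes33 v k lam"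
  shows "(\<Sum>p\<in>{1..v} \<times> {1..v}. (int v * int (row_sum v A d p) - int k)\<^sup>2)
    = (int v)\<^sup>2 * (int lam * int v * (int v - 1) - int k * (int k - int v))"
proof -
  let ?P = "{1..v} \<times> {1..v}"
  let ?r = "\<lambda>p. int (row_sum v A d p)"
  have s1: "(\<Sum>p\<in>?P. ?r p) = int v * int k"
    using sum_row_sum[OF assms(2)] by (simp flip: of_nat_sum of_nat_mult)
  have "(\<Sum>p\<in>?P. (?r p)\<^sup>2) = int (v * (k + (v - 1) * lam))"
    using sum_row_sum_square[OF assms(2)] by (simp only: of_nat_sum[symmetric] of_nat_power[symmetric])
  then have s2: "(\<Sum>p\<in>?P. (?r p)\<^sup>2) = int v * (int k + (int v - 1) * int lam)"
    using assms(1) by (simp add: of_nat_diff)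
  have "(\<Sum>p\<in>?P. (int v * ?r p - int k)\<^sup>2)
      = (\<Sum>p\<in>?P. (int v)\<^sup>2 * (?r p)\<^sup>2 - 2 * int v * int k * ?r p + (int k)\<^sup>2)"
    by (intro sum.cong refl) (simp add: power2_eq_square algebra_simps)
  also have "\<dots> = (int v)\<^sup>2 * (\<Sum>p\<in>?P. (?r p)\<^sup>2) - 2 * int v * int k * (\<Sum>p\<in>?P. ?r p)
      + (int v)\<^sup>2 * (int k)\<^sup>2"
    by (simp add: sum.distrib sum_subtractf sum_distrib_left power2_eq_square)
  finally show ?thesis
    unfolding s1 s2 by (simp add: power2_eq_square algebra_simps)
qed

lemma admissible_of_row_sum_constant:
  fixes v k lam r :: nat
  assumes "v \<ge> 1" "k = v * r" "int lam * int v * (int v - 1) = int k * (int k - int v)"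
  shows "\<exists>lam'. lam = v * lam' \<and> admissible v r lam'"
proof -
  have "int v * (int lam * (int v - 1)) = int v * (int v * (int r * (int r - 1)))"
    using assms(3) unfolding assms(2) by (simp add: algebra_simps)
  then have eq: "int lam * (int v - 1) = int v * (int r * (int r - 1))"
    using assms(1) by simp
  \<comment> \<open>Coprimality of \<open>v\<close> and \<open>v - 1\<close> made explicit:
    \<open>lam\<close> is \<open>v * lam\<close> minus \<open>(v - 1) * lam\<close>, and both are
    multiples of \<open>v\<close>.\<close>
  have "int lam = int v * (int lam - int r * (int r - 1))"
    using eq by (simp add: algebra_simps)
  then have "v dvd lam"
    by (metis dvd_triv_left of_nat_dvd_iff)
  then obtain m where m: "lam = v * m" ..
  have "int v * (int m * (int v - 1)) = int v * (int r * (int r - 1))"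
    using eq unfolding m by (simp add: algebra_simps)
  then show ?thesis
    using assms(1) m by (auto simp: admissible_def)
qed

theorem proposition2p1:
  fixes v k lam :: nat and A :: "nat \<times> nat \<times> nat \<Rightarrow> nat"
  assumes "v \<ge> 1" and "A \<in> cubes33 v k lam"
  shows "int lam * int v * (int v - 1) \<ge> int k * (int k - int v)
    \<and> (int lam * int v * (int v - 1) = int k * (int k - int v) \<longleftrightarrow>
         (\<forall>d. \<forall>p\<in>{1..v} \<times> {1..v}. real (row_sum v A d p) = real k / real v))
    \<and> (int lam * int v * (int v - 1) = int k * (int k - int v) \<longrightarrow>
         (\<exists>k' lam'. k = v * k' \<and> lam = v * lam' \<and> admissible v k' lam'))"
proof -
  define D where "D = int lam * int v * (int v - 1) - int k * (int k - int v)"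
  have dev: "(\<Sum>p\<in>{1..v} \<times> {1..v}. (int v * int (row_sum v A d p) - int k)\<^sup>2) = (int v)\<^sup>2 * D" for d
    using row_sum_deviation[OF assms] by (simp add: D_def)
  have v: "(int v)\<^sup>2 > 0" using assms(1) by simp
  have "(int v)\<^sup>2 * D \<ge> 0"
    unfolding dev[of Axis1, symmetric] by (intro sum_nonneg) simp
  then have nonneg: "D \<ge> 0"
    using v by (simp add: zero_le_mult_iff)
  \<comment> \<open>\<open>D\<close> does not depend on \<open>d\<close>, so constant row-sums in
    one direction already force them in all three.\<close>
  have D0: "D = 0 \<longleftrightarrow> (\<forall>p\<in>{1..v} \<times> {1..v}. v * row_sum v A d p = k)" for d
  proof -
    have "D = 0 \<longleftrightarrow> (\<Sum>p\<in>{1..v} \<times> {1..v}. (int v * int (row_sum v A d p) - int k)\<^sup>2) = 0"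
      unfolding dev using v by simp
    also have "\<dots> \<longleftrightarrow> (\<forall>p\<in>{1..v} \<times> {1..v}. (int v * int (row_sum v A d p) - int k)\<^sup>2 = 0)"
      by (rule sum_nonneg_eq_0_iff) auto
    also have "\<dots> \<longleftrightarrow> (\<forall>p\<in>{1..v} \<times> {1..v}. v * row_sum v A d p = k)"
      by (simp flip: of_nat_mult)
    finally show ?thesis .
  qed
  have real_iff: "real n = real k / real v \<longleftrightarrow> v * n = k" for n
    using assms(1) by (simp add: eq_divide_eq mult.commute flip: of_nat_mult)
  have eq_iff: "int lam * int v * (int v - 1) = int k * (int k - int v) \<longleftrightarrow> D = 0"
    by (simp add: D_def)
  have "\<exists>k' lam'. k = v * k' \<and> lam = v * lam' \<and> admissible v k' lam'" if "D = 0"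
  proof -
    \<comment> \<open>Any position would do: all row-sums agree when \<open>D = 0\<close>, and their
      common value serves as \<open>k'\<close>. The position exists because \<open>v\<close> is
      positive.\<close>
    have "(1, 1) \<in> {1..v} \<times> {1..v}" using assms(1) by simp
    then have "k = v * row_sum v A Axis1 (1, 1)"
      using that D0[of Axis1] by metis
    then show ?thesis
      using admissible_of_row_sum_constant[OF assms(1)] that eq_iff by blast
  qed
  moreover have "D = 0 \<longleftrightarrow> (\<forall>d. \<forall>p\<in>{1..v} \<times> {1..v}. v * row_sum v A d p = k)"
    unfolding D0[symmetric] by simp
  moreover have "int lam * int v * (int v - 1) \<ge> int k * (int k - int v)"
    using nonneg by (simp add: D_def)
  ultimately show ?thesis
    unfolding eq_iff real_iff by blast
qed

end
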